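(* Let $\mathbb{K}$ be $\mathbb{R}$ or $\mathbb{C}$, and regard $[0,\infty)$ as an exponential vector space over $\mathbb{K}$ with the usual addition, the scalar multiplication $\alpha\cdot x:=|\alpha|x$ and the usual order. The usual subspace topology (inherited from $\mathbb{R}$) is the finest topology with respect to which $[0,\infty)$ forms a topological exponential vector space over $\mathbb{K}$; that is, $[0,\infty)$ with the usual subspace topology $\tau$ is a topological exponential vector space over $\mathbb{K}$, and every topology $\tau'$ on $[0,\infty)$ making it a topological exponential vector space over $\mathbb{K}$ satisfies $\tau'\subseteq\tau$.
   Context: An exponential vector space (evs) over a field $K$ is a partially ordered set $(X,\leq)$ with a binary operation $+$ on $X$ and a scalar multiplication $\cdot:K\times X\to X$ such that for all $x,y,z\in X$, $\alpha,\beta\in K$: ($A_1$) $(X,+)$ is a commutative semigroup with identity $\theta$; ($A_2$) $x\leq y$ implies $x+z\leq y+z$ and $\alpha\cdot x\leq\alpha\cdot y$; ($A_3$) $\alpha\cdot(x+y)=\alpha\cdot x+\alpha\cdot y$, $\alpha\cdot(\beta\cdot x)=(\alpha\beta)\cdot x$, $(\alpha+\beta)\cdot x\leq\alpha\cdot x+\beta\cdot x$, $1\cdot x=x$; ($A_4$) $\alpha\cdot x=\theta$ iff $\alpha=0$ or $x=\theta$; ($A_5$) $x+(-1)\cdot x=\theta$ iff $x\in X_0:=\{z\in X: y\nleq z\ \forall y\in X\smallsetminus\{z\}\}$ (the set of minimal elements); ($A_6$) for each $x\in X$ there is $p\in X_0$ with $p\leq x$. A topological evs over $\mathbb{K}$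 ($=\mathbb{R}$ or $\mathbb{C}$, usual topology) is an evs $X$ over $\mathbb{K}$ with a topology such that addition $X\times X\to X$ and scalar multiplication $\mathbb{K}\times X\to X$ are continuous and the partial order is closed, i.e. $\{(x,y)\in X\times X:x\leq y\}$ is closed in $X\times X$. *)

theory Defs
  imports "HOL-Analysis.Analysis"
begin

definition minimal_elements :: "'a set \<Rightarrow> ('a \<Rightarrow> 'a \<Rightarrow> bool) \<Rightarrow> 'a set" where
  "minimal_elements X le = {z \<in> X. \<forall>y \<in> X - {z}. \<not> le y z}"

text \<open>Exponential vector spaces on an explicit carrier \<open>X\<close>. The values of the operations and of the
  order outside \<open>X\<close> are irrelevant.\<close>

locale evs =
  fixes X :: "'a set"
    and le :: "'a \<Rightarrow> 'a \<Rightarrow> bool"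
    and add :: "'a \<Rightarrow> 'a \<Rightarrow> 'a"
    and zero :: 'a
    and scale :: "'k::field \<Rightarrow> 'a \<Rightarrow> 'a"
  assumes partial_order: "partial_order_on X {(x, y) \<in> X \<times> X. le x y}"
    and add_closed: "\<lbrakk>x \<in> X; y \<in> X\<rbrakk> \<Longrightarrow> add x y \<in> X"
    and scale_closed: "x \<in> X \<Longrightarrow> scale a x \<in> X"
    and add_assoc: "\<lbrakk>x \<in> X; y \<in> X; z \<in> X\<rbrakk> \<Longrightarrow> add (add x y) z = add x (add y z)"
    and add_commute: "\<lbrakk>x \<in> X; y \<in> X\<rbrakk> \<Longrightarrow> add x y = add y x"
    and zero_closed: "zero \<in> X"
    and add_zero: "x \<in> X \<Longrightarrow> add x zero = x"
    and add_mono: "\<lbrakk>x \<in> X; y \<in> X; z \<in> X; le x y\<rbrakk> \<Longrightarrow> le (add x z) (add y z)"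
    and scale_mono: "\<lbrakk>x \<in> X; y \<in> X; le x y\<rbrakk> \<Longrightarrow> le (scale a x) (scale a y)"
    and scale_add: "\<lbrakk>x \<in> X; y \<in> X\<rbrakk> \<Longrightarrow> scale a (add x y) = add (scale a x) (scale a y)"
    and scale_scale: "x \<in> X \<Longrightarrow> scale a (scale b x) = scale (a * b) x"
    and add_scale_le: "x \<in> X \<Longrightarrow> le (scale (a + b) x) (add (scale a x) (scale b x))"
    and scale_one: "x \<in> X \<Longrightarrow> scale 1 x = x"
    and scale_eq_zero_iff: "x \<in> X \<Longrightarrow> scale a x = zero \<longleftrightarrow> a = 0 \<or> x = zero"
    and add_neg_eq_zero_iff:
      "x \<in> X \<Longrightarrow> add x (scale (- 1) x) = zero \<longleftrightarrow> x \<in> minimal_elements X le"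
    and minimal_below: "x \<in> X \<Longrightarrow> \<exists>p \<in> minimal_elements X le. le p x"

text \<open>The scalar field carries its norm topology; the class \<open>real_normed_field\<close> covers both
  \<open>real\<close> and \<open>complex\<close>.\<close>

locale topological_evs = evs X le add zero scale
  for X :: "'a set"
    and le :: "'a \<Rightarrow> 'a \<Rightarrow> bool"
    and add :: "'a \<Rightarrow> 'a \<Rightarrow> 'a"
    and zero :: 'a
    and scale :: "'k::real_normed_field \<Rightarrow> 'a \<Rightarrow> 'a" +
  fixes T :: "'a topology"
  assumes topspace_eq: "topspace T = X"
    and continuous_add: "continuous_map (prod_topology T T) T (\<lambda>(x, y). add x y)"
    and continuous_scale: "continuous_map (prod_topology euclidean T) T (\<lambda>(a, x). scale a x)"
    and closed_order: "closedin (prod_topology T T) {(x, y) \<in> X \<times> X. le x y}"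

definition norm_scale :: "'k::real_normed_field \<Rightarrow> real \<Rightarrow> real" where
  "norm_scale a x = norm a * x"

end

theory Submission
  imports Defs
begin

text \<open>
  The half-line is a single ray of scalar multiples of \<open>1\<close>: for \<open>t \<ge> 0\<close> one has
  \<open>t = |t| \<cdot> 1\<close>. In any topological exponential vector space the orbit map
  \<open>a \<mapsto> a \<cdot> x\<close> of a point is continuous on the scalar field, whose topology is fixed to be the
  usual one. Composing the orbit map of \<open>1\<close> with the inclusion of \<open>[0, \<infinity>)\<close> into the scalars
  yields the identity map, which is therefore continuous from the usual topology to the given
  topology. This says exactly that the given topology is coarser than the usual one.

  That the usual topology itself qualifies is elementary: the triangle inequality in the scalar
  field gives \<open>|a + b| x \<le> |a| x + |b| x\<close>, the only minimal element is \<open>0\<close>, and the operations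
  and the order are restrictions of continuous operations and a closed order on the reals.

  Every real normed field contains the reals with \<open>norm (of_real t) = |t|\<close>, so both parts hold
  uniformly over such fields; the reals and the complex numbers are instances.
\<close>

lemma minimal_elements_half_line: "minimal_elements {0::real..} (\<le>) = {0}"
  unfolding minimal_elements_def by force

lemma evs_half_line:
  "evs {0::real..} (\<le>) (+) 0 (norm_scale :: 'k::real_normed_field \<Rightarrow> real \<Rightarrow> real)"
proof
  show "partial_order_on {0::real..} {(x, y) \<in> {0..} \<times> {0..}. x \<le> y}"
    unfolding partial_order_on_def preorder_on_def refl_on_def trans_def antisym_def by auto
next
  fix a b :: 'k and x :: real
  assume "x \<in> {0..}"
  then have "norm (a + b) * x \<le> (norm a + norm b) * x"
    by (intro mult_right_mono norm_triangle_ineq) auto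
  then show "norm_scale (a + b) x \<le> norm_scale a x + norm_scale b x"
    by (simp add: norm_scale_def distrib_right)
qed (auto simp: norm_scale_def norm_mult minimal_elements_half_line distrib_left mult_left_mono)

lemma topological_evs_half_line:
  "topological_evs {0::real..} (\<le>) (+) 0
     (norm_scale :: 'k::real_normed_field \<Rightarrow> real \<Rightarrow> real) (top_of_set {0..})"
proof -
  interpret evs "{0::real..}" "(\<le>)" "(+)" 0 "norm_scale :: 'k \<Rightarrow> real \<Rightarrow> real"
    by (rule evs_half_line)
  show ?thesis
  proof
    show "topspace (top_of_set {0::real..}) = {0..}"
      by simp
    have "continuous_on ({0::real..} \<times> {0..}) (\<lambda>(x, y). x + y)"
      unfolding split_def by (intro continuous_intros)
    then show "continuous_map (prod_topology (top_of_set {0..}) (top_of_set {0..}))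
        (top_of_set {0::real..}) (\<lambda>(x, y). x + y)"
      by (auto simp: continuous_map_in_subtopology)
    have "continuous_on (UNIV \<times> {0::real..}) (\<lambda>(a::'k, x). norm_scale a x)"
      unfolding split_def norm_scale_def by (intro continuous_intros)
    moreover have "prod_topology (euclidean :: 'k topology) (top_of_set {0::real..})
        = top_of_set (UNIV \<times> {0..})"
      using prod_topology_subtopology_eu[of "UNIV :: 'k set" "{0::real..}"] by simp
    ultimately show "continuous_map (prod_topology euclidean (top_of_set {0..}))
        (top_of_set {0::real..}) (\<lambda>(a::'k, x). norm_scale a x)"
      by (auto simp: continuous_map_in_subtopology norm_scale_def)
    have "closed {z :: real \<times> real. fst z \<le> snd z}"
      by (intro closed_Collect_le continuous_intros)
    moreover have "{(x, y) \<in> {0::real..} \<times> {0..}. x \<le> y}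
        = ({0..} \<times> {0..}) \<inter> {z. fst z \<le> snd z}"
      by auto
    ultimately show "closedin (prod_topology (top_of_set {0..}) (top_of_set {0..}))
        {(x, y) \<in> {0::real..} \<times> {0..}. x \<le> y}"
      by (simp add: closedin_closed_Int)
  qed
qed

text \<open>Along an orbit the usual topology of the scalars is carried continuously into the space; this
  is what bounds the topology of the half-line from above.\<close>

lemma (in topological_evs) continuous_map_orbit:
  assumes "x \<in> X"
  shows "continuous_map euclidean T (\<lambda>a. scale a x)"
proof -
  have "continuous_map euclidean (prod_topology euclidean T) (\<lambda>a. (a, x))"
    using assms by (simp add: continuous_map_pairedI topspace_eq)
  from continuous_map_compose[OF this continuous_scale] show ?thesis
    by (simp add: comp_def)
qed

lemma half_line_topology_coarser_than_usual:
  assumes "topological_evs {0::real..} (\<le>) (+) 0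
             (norm_scale :: 'k::real_normed_field \<Rightarrow> real \<Rightarrow> real) T'"
    and U: "openin T' U"
  shows "openin (top_of_set {0..}) U"
proof -
  interpret topological_evs "{0::real..}" "(\<le>)" "(+)" 0 "norm_scale :: 'k \<Rightarrow> real \<Rightarrow> real" T'
    by (rule assms(1))
  have orbit: "continuous_map euclidean T' (\<lambda>a::'k. norm_scale a 1)"
    by (rule continuous_map_orbit) simp
  have "continuous_map (top_of_set {0..}) euclidean (of_real :: real \<Rightarrow> 'k)"
    by (simp add: continuous_on_of_real)
  from continuous_map_compose[OF this orbit]
  have "continuous_map (top_of_set {0::real..}) T' (\<lambda>t. \<bar>t\<bar>)"
    by (simp add: comp_def norm_scale_def)
  then have "continuous_map (top_of_set {0::real..}) T' (\<lambda>t. t)"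
    by (rule continuous_map_eq) simp
  from openin_continuous_map_preimage[OF this U]
  have "openin (top_of_set {0..}) {t \<in> {0..}. t \<in> U}"
    by simp
  moreover have "{t \<in> {0..}. t \<in> U} = U"
    using openin_subset[OF U] topspace_eq by auto
  ultimately show ?thesis
    by simp
qed

theorem theorem6p9:
  shows "(topological_evs {0::real..} (\<le>) (+) 0 (norm_scale :: real \<Rightarrow> real \<Rightarrow> real) (top_of_set {0..}) \<and>
          (\<forall>T'. topological_evs {0::real..} (\<le>) (+) 0 (norm_scale :: real \<Rightarrow> real \<Rightarrow> real) T' \<longrightarrow>
            (\<forall>U. openin T' U \<longrightarrow> openin (top_of_set {0..}) U))) \<and>
         (topological_evs {0::real..} (\<le>) (+) 0 (norm_scale :: complex \<Rightarrow> real \<Rightarrow> real) (top_of_set {0..}) \<and>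
          (\<forall>T'. topological_evs {0::real..} (\<le>) (+) 0 (norm_scale :: complex \<Rightarrow> real \<Rightarrow> real) T' \<longrightarrow>
            (\<forall>U. openin T' U \<longrightarrow> openin (top_of_set {0..}) U)))"
  by (intro conjI allI impI topological_evs_half_line) (erule (1) half_line_topology_coarser_than_usual)+

end
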